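(* Let $n,c,r\in\mathbb{N}$ and $q_1,\ldots,q_n\in(0,1)$. (i) Let $d\ge2$ be a finite integer, $q_{j,k}=(1-d^{k-1-c})q_j$, let $X_{j,k}\sim\mathrm{Geo}(q_{j,k})$ be independent for $1\le j\le n$, $1\le k\le c$, $Y_j^{(c)}=\sum_{k=1}^cX_{j,k}$, and $Y_{n:n}^{(c)}=\max_jY_j^{(c)}$. Then $$\mathbb{E}\bigl[(Y_{n:n}^{(c)})^r\bigr]=c^r+\sum_{m=c^r}^\infty\Bigl(1-\prod_{j=1}^n\sum_{t=c}^{\lfloor m^{1/r}\rfloor}\sum_{\boldsymbol\alpha\in\mathcal{A}_t}\prod_{k=1}^c(1-q_{j,k})^{\alpha_k-1}q_{j,k}\Bigr),$$ where $\mathcal{A}_t=\{\boldsymbol\alpha=(\alpha_1,\ldots,\alpha_c)\in\mathbb{N}^c:\ \sum_{k=1}^c\alpha_k=t\}$. (ii) If instead $X_{j,k}\sim\mathrm{Geo}(q_j)$ for all $k$ (independent over $j,k$), with $Y_j^{(c)}$ and $Y_{n:n}^{(c)}$ defined in the same way from these $X_{j,k}$, then $$\mathbb{E}\bigl[(Y_{n:n}^{(c)})^r\bigr]=c^r+\sum_{m=c^r}^\infty\Bigl(1-\prod_{j=1}^n\sum_{t=c}^{\lfloor m^{1/r}\rfloor}\binom{t-1}{c-1}(1-q_j)^{t-c}q_j^c\Bigr)=c^r+\sum_{m=c^r}^\infty\Bigl(1-\prod_{j=1}^nI_{q_j}\bigl(c,\lfloor m^{1/r}\rfloor-c+1\b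igr)\Bigr).$$
   Context: $\mathbb{N}=\{1,2,\ldots\}$. $\mathrm{Geo}(q)$ is the geometric distribution on $\{1,2,\ldots\}$ with $\mathbb{P}(X=k)=(1-q)^{k-1}q$. $I_x(a,b)=\int_0^x t^{a-1}(1-t)^{b-1}dt\big/\int_0^1 t^{a-1}(1-t)^{b-1}dt$ is the regularized incomplete beta function. *)

theory Defs
  imports "HOL-Probability.Probability"
begin

text \<open>The geometric distribution on \<open>{1, 2, \<dots>}\<close>; the library's \<^const>\<open>geometric_pmf\<close>
  counts failures and starts at \<open>0\<close>.\<close>

definition Geo :: "real \<Rightarrow> nat pmf" where
  "Geo q = map_pmf Suc (geometric_pmf q)"

lemma pmf_Geo:
  assumes "q \<in> {0<..1}"
  shows "pmf (Geo q) k = (if k = 0 then 0 else (1 - q) ^ (k - 1) * q)"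
proof (cases k)
  case 0
  then show ?thesis
    by (auto simp: Geo_def pmf_eq_0_set_pmf)
next
  case (Suc i)
  then show ?thesis
    using assms by (simp add: Geo_def pmf_map_inj')
qed

text \<open>Only the variables \<open>X j k\<close> with \<open>1 \<le> j \<le> n\<close> and \<open>1 \<le> k \<le> c\<close> are constrained.\<close>

definition indep_geo :: "'a measure \<Rightarrow> nat \<Rightarrow> nat \<Rightarrow> (nat \<Rightarrow> nat \<Rightarrow> real) \<Rightarrow>
    (nat \<Rightarrow> nat \<Rightarrow> 'a \<Rightarrow> nat) \<Rightarrow> bool" where
  "indep_geo M n c p X \<longleftrightarrow>
     prob_space.indep_vars M (\<lambda>_. count_space UNIV) (\<lambda>(j, k). X j k) ({1..n} \<times> {1..c}) \<and>
     (\<forall>j\<in>{1..n}. \<forall>k\<in>{1..c}. distr M (count_space UNIV) (X j k) = measure_pmf (Geo (p j k)))"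

definition Ysum :: "nat \<Rightarrow> (nat \<Rightarrow> nat \<Rightarrow> 'a \<Rightarrow> nat) \<Rightarrow> nat \<Rightarrow> 'a \<Rightarrow> nat" where
  "Ysum c X j \<omega> = (\<Sum>k=1..c. X j k \<omega>)"

definition Ymax :: "nat \<Rightarrow> nat \<Rightarrow> (nat \<Rightarrow> nat \<Rightarrow> 'a \<Rightarrow> nat) \<Rightarrow> 'a \<Rightarrow> nat" where
  "Ymax n c X \<omega> = (MAX j\<in>{1..n}. Ysum c X j \<omega>)"

definition compositions :: "nat \<Rightarrow> nat \<Rightarrow> (nat \<Rightarrow> nat) set" where
  "compositions c t = {\<alpha> \<in> {1..c} \<rightarrow>\<^sub>E {1..}. (\<Sum>k=1..c. \<alpha> k) = t}"

definition floor_root :: "nat \<Rightarrow> nat \<Rightarrow> nat" where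
  "floor_root r m = nat \<lfloor>real m powr (1 / real r)\<rfloor>"

definition reg_inc_beta :: "real \<Rightarrow> real \<Rightarrow> real \<Rightarrow> real" where
  "reg_inc_beta x a b =
     integral {0..x} (\<lambda>t. t powr (a - 1) * (1 - t) powr (b - 1)) /
     integral {0..1} (\<lambda>t. t powr (a - 1) * (1 - t) powr (b - 1))"

end

theory Submission
  imports Defs
begin

text \<open>
  As \<open>Ymax\<close> is at least \<open>c\<close> almost surely, the tail formula \<open>E N = (\<Sum>m. P(N > m))\<close> applied to
  \<open>N = Ymax ^ r\<close> has its first \<open>c ^ r\<close> summands equal to \<open>1\<close>; in the others, \<open>N \<le> m\<close> means
  \<open>Ymax \<le> floor_root r m\<close>, and independence factorises this probability over \<open>j\<close> and then over
  \<open>k\<close> along compositions. For equal parameters, counting compositions gives the negative binomial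
  distribution function; its derivative in \<open>q\<close> telescopes to a multiple of the beta integrand.
\<close>

section \<open>Moments of the geometric distribution\<close>

lemma summable_power_times_geometric:
  fixes x :: real
  assumes "norm x < 1"
  shows "summable (\<lambda>n. real n ^ r * x ^ n)"
  using assms
proof (induction r arbitrary: x)
  case 0
  then show ?case by (simp add: summable_geometric)
next
  case (Suc r)
  \<comment> \<open>Termwise differentiation raises the power of n by one, and multiplying by x
    restores the exponent. The induction is over arbitrary x because differentiation requires
    convergence on the whole open unit disc.\<close>
  have "summable (\<lambda>n. diffs (\<lambda>n. real n ^ r) n * x ^ n)"
    by (rule termdiff_converges[OF Suc.prems Suc.IH])
  from summable_mult[OF this, of x] have "summable (\<lambda>n. real (Suc n) ^ Suc r * x ^ Suc n)"
    by (simp add: diffs_def mult_ac)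
  then show ?case
    by (subst (asm) summable_Suc_iff)
qed

lemma integrable_power_Geo:
  assumes "q \<in> {0<..1}"
  shows "integrable (measure_pmf (Geo q)) (\<lambda>k. real k ^ r)"
proof -
  \<comment> \<open>The shift to \<open>Suc k\<close> leaves out the exceptional mass 0 at 0. For q
    < 1 the mass at \<open>Suc k\<close> is q/(1-q) times (1-q)^(k+1); as this divides by 1 - q, the
    point mass q = 1 is treated apart.\<close>
  have "summable (\<lambda>k. real (Suc k) ^ r * (pmf (Geo q) (Suc k)))"
  proof (cases "q = 1")
    case True
    then show ?thesis
      by (subst summable_Suc_iff, intro summable_finite[of "{..1}"]) (auto simp: pmf_Geo)
  next
    case False
    have "summable (\<lambda>k. q / (1 - q) * (real (Suc k) ^ r * (1 - q) ^ Suc k))"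
      using assms False summable_power_times_geometric[of "1 - q" r]
      by (intro summable_mult, subst summable_Suc_iff) auto
    moreover have "(\<lambda>k. q / (1 - q) * (real (Suc k) ^ r * (1 - q) ^ Suc k)) =
        (\<lambda>k. real (Suc k) ^ r * (pmf (Geo q) (Suc k)))"
      using assms False by (auto simp: pmf_Geo field_simps)
    ultimately show ?thesis by simp
  qed
  then have "summable (\<lambda>k. real k ^ r * pmf (Geo q) k)"
    by (subst (asm) summable_Suc_iff)
  then show ?thesis
    unfolding measure_pmf_eq_density
    by (subst integrable_density) (auto simp: integrable_count_space_nat_iff mult.commute)
qed

text \<open>A natural number lies below the floor of z exactly when it lies below z, and r-th powers
  are monotone. This turns events about \<open>Ymax ^ r\<close> into events about
  \<open>Ymax\<close>.\<close>

lemma le_floor_root_iff: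
  assumes "r \<ge> 1" "m \<ge> 1"
  shows "y \<le> floor_root r m \<longleftrightarrow> y ^ r \<le> m"
proof -
  define z where "z = real m powr (1 / real r)"
  have z: "z > 0" "z ^ r = real m"
    using assms by (auto simp: z_def powr_powr simp flip: powr_realpow)
  have "y \<le> floor_root r m \<longleftrightarrow> real y \<le> z"
    using z by (simp add: floor_root_def flip: z_def) linarith
  also have "\<dots> \<longleftrightarrow> real y ^ r \<le> z ^ r"
    using z assms by (intro power_mono_iff[symmetric]) auto
  also have "\<dots> \<longleftrightarrow> y ^ r \<le> m"
    unfolding z(2) by (simp flip: of_nat_power)
  finally show ?thesis .
qed

section \<open>Counting compositions\<close>

lemma finite_compositions: "finite (compositions c t)"
proof (rule finite_subset)
  show "compositions c t \<subseteq> {1..c} \<rightarrow>\<^sub>E {..t}"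
  proof
    fix \<alpha> assume \<alpha>: "\<alpha> \<in> compositions c t"
    have "\<alpha> k \<le> t" if "k \<in> {1..c}" for k
      using \<alpha> member_le_sum[of k "{1..c}" \<alpha>] that by (auto simp: compositions_def)
    with \<alpha> show "\<alpha> \<in> {1..c} \<rightarrow>\<^sub>E {..t}"
      by (auto simp: compositions_def PiE_iff)
  qed
qed (auto intro: finite_PiE)

text \<open>Stars and bars: lowering every part by 1 gives a bijection onto the lists of c natural
  numbers with sum t - c.\<close>

lemma card_compositions:
  assumes "c \<ge> 1" "t \<ge> c"
  shows "card (compositions c t) = (t - 1) choose (c - 1)"
proof -
  define L where "L = {l::nat list. length l = c \<and> sum_list l = t - c}"
  have eq: "(\<Sum>k=Suc 0..c. g k) = (\<Sum>i<c. g (Suc i))" for g :: "nat \<Rightarrow> nat"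
    using sum.atLeast1_atMost_eq[of g c] by simp
  have "bij_betw (\<lambda>\<alpha>. map (\<lambda>i. \<alpha> (Suc i) - 1) [0..<c]) (compositions c t) L"
  proof (rule bij_betwI[where g = "\<lambda>l. \<lambda>k\<in>{1..c}. Suc (l ! (k - 1))"])
    show "(\<lambda>\<alpha>. map (\<lambda>i. \<alpha> (Suc i) - 1) [0..<c]) \<in> compositions c t \<rightarrow> L"
    proof
      fix \<alpha> assume \<alpha>: "\<alpha> \<in> compositions c t"
      \<comment> \<open>All parts are at least 1, so the truncated subtraction is exact and can be
        undone by adding 1.\<close>
      have "(\<Sum>i<c. \<alpha> (Suc i)) = (\<Sum>i<c. (\<alpha> (Suc i) - 1) + 1)"
        using \<alpha> by (intro sum.cong) (auto simp: compositions_def PiE_iff Suc_le_eq)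
      then have "(\<Sum>i<c. \<alpha> (Suc i)) = (\<Sum>i<c. (\<alpha> (Suc i) - 1)) + c"
        by (simp only: sum.distrib) simp
      then show "map (\<lambda>i. \<alpha> (Suc i) - 1) [0..<c] \<in> L"
        using \<alpha> by (auto simp: L_def compositions_def eq interv_sum_list_conv_sum_set_nat atLeast0LessThan)
    qed
    show "(\<lambda>l. \<lambda>k\<in>{1..c}. Suc (l ! (k - 1))) \<in> L \<rightarrow> compositions c t"
      using assms
      by (auto simp: L_def compositions_def eq sum_list_sum_nth atLeast0LessThan sum_Suc)
    show "(\<lambda>k\<in>{1..c}. Suc (map (\<lambda>i. \<alpha> (Suc i) - 1) [0..<c] ! (k - 1))) = \<alpha>"
      if "\<alpha> \<in> compositions c t" for \<alpha>
    proof
      fix k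
      have "\<alpha> k \<ge> 1" if "k \<in> {1..c}"
        using that \<open>\<alpha> \<in> compositions c t\<close> by (auto simp: compositions_def)
      \<comment> \<open>Extensionality fixes the values outside \<open>{1..c}\<close>, so the
        restricted inverse recovers the whole function.\<close>
      moreover have "\<alpha> k = undefined" if "k \<notin> {1..c}"
        using that \<open>\<alpha> \<in> compositions c t\<close>
        by (auto simp: compositions_def PiE_iff extensional_def)
      ultimately show "(\<lambda>k\<in>{1..c}. Suc (map (\<lambda>i. \<alpha> (Suc i) - 1) [0..<c] ! (k - 1))) k = \<alpha> k"
        by auto
    qed
    show "map (\<lambda>i. (\<lambda>k\<in>{1..c}. Suc (l ! (k - 1))) (Suc i) - 1) [0..<c] = l" if "l \<in> L" for l
      using that by (auto simp: L_def intro!: nth_equalityI)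
  qed
  then have "card (compositions c t) = card L"
    by (rule bij_betw_same_card)
  also have "\<dots> = (t - c + c - 1) choose (t - c)"
    unfolding L_def by (rule card_length_sum_list)
  also have "\<dots> = (t - 1) choose (c - 1)"
    using assms binomial_symmetric[of "c - 1" "t - 1"] by simp
  finally show ?thesis .
qed

text \<open>With a common parameter the product is the same for every composition of t, because the
  exponents add up to t - c; only the number of compositions remains.\<close>

lemma sum_compositions_geometric:
  fixes q :: real
  assumes "c \<ge> 1" "t \<ge> c"
  shows "(\<Sum>\<alpha>\<in>compositions c t. \<Prod>k=1..c. (1 - q) ^ (\<alpha> k - 1) * q) =
    real ((t - 1) choose (c - 1)) * (1 - q) ^ (t - c) * q ^ c"
proof -
  have "(\<Prod>k=1..c. (1 - q) ^ (\<alpha> k - 1) * q) = (1 - q) ^ (t - c) * q ^ c"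
    if "\<alpha> \<in> compositions c t" for \<alpha>
  proof -
    have "(\<Sum>k=1..c. \<alpha> k - 1) = (\<Sum>k=1..c. \<alpha> k) - (\<Sum>k=1..c. 1)"
      using that by (intro sum_subtractf_nat) (auto simp: compositions_def PiE_iff)
    then show ?thesis
      using that by (simp add: prod.distrib compositions_def flip: power_sum)
  qed
  then show ?thesis
    using card_compositions[OF assms] by simp
qed

section \<open>The negative binomial distribution function as an incomplete beta function\<close>

text \<open>The constant is 1/B(c, s-c+1), so the derivative is a beta density. In the induction on
  s, the derivative of the new summand combines with the old density into the next one.\<close>

lemma neg_binomial_cdf_deriv:
  fixes x :: real
  assumes "c \<ge> 1" "c \<le> s"
  shows "((\<lambda>x. \<Sum>t=c..s. real ((t - 1) choose (c - 1)) * (1 - x) ^ (t - c) * x ^ c)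
    has_real_derivative real (s * ((s - 1) choose (c - 1))) * (x ^ (c - 1) * (1 - x) ^ (s - c)))
    (at x within S)"
  using assms(2)
proof (induction s rule: dec_induct)
  case base
  then show ?case
    using assms(1) by (auto intro!: derivative_eq_intros)
next
  case (step s)
  \<comment> \<open>The coefficient of the new summand t = s + 1. By absorption the previous
    constant is (s+1-c) times \<open>b\<close>, which makes the two derivatives comparable.\<close>
  define b where "b = real (s choose (c - 1))"
  have b: "real (s * ((s - 1) choose (c - 1))) = real (Suc s - c) * b"
  proof -
    have "s * ((s - 1) choose (c - 1)) = (Suc s - c) * (s choose (c - 1))"
      using binomial_absorb_comp[of s "c - 1"] assms(1) step.hyps by (simp add: Suc_diff_le)
    then show ?thesis unfolding b_def by (metis of_nat_mult)
  qed
  \<comment> \<open>These substitutions remove truncated subtraction from the exponents before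
    differentiating.\<close>
  obtain c' where c': "c = Suc c'" using assms(1) by (cases c) auto
  obtain e where e: "s = c + e" using step.hyps by (metis le_Suc_ex)
  have "((\<lambda>x. b * (1 - x) ^ (Suc s - c) * x ^ c) has_real_derivative
      b * (x ^ (c - 1) * (1 - x) ^ (s - c)) * (real c * (1 - x) - real (Suc s - c) * x)) (at x within S)"
  proof -
    have "((\<lambda>x. b * (1 - x) ^ Suc e * x ^ Suc c') has_real_derivative
        b * (real (Suc e) * (1 - x) ^ e * (- 1)) * x ^ Suc c' +
        b * (1 - x) ^ Suc e * (real (Suc c') * x ^ c')) (at x within S)"
      by (rule derivative_eq_intros refl | simp del: power_Suc)+
    then show ?thesis
      by (simp add: c' e algebra_simps)
  qed
  from DERIV_add[OF step.IH this]
  have "((\<lambda>x. \<Sum>t=c..Suc s. real ((t - 1) choose (c - 1)) * (1 - x) ^ (t - c) * x ^ c)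
    has_real_derivative real (s * ((s - 1) choose (c - 1))) * (x ^ (c - 1) * (1 - x) ^ (s - c)) +
      b * (x ^ (c - 1) * (1 - x) ^ (s - c)) * (real c * (1 - x) - real (Suc s - c) * x)) (at x within S)"
    using step.hyps by (simp add: b_def)
  also have "real (s * ((s - 1) choose (c - 1))) * (x ^ (c - 1) * (1 - x) ^ (s - c)) +
      b * (x ^ (c - 1) * (1 - x) ^ (s - c)) * (real c * (1 - x) - real (Suc s - c) * x) =
    real (Suc s * ((Suc s - 1) choose (c - 1))) * (x ^ (c - 1) * (1 - x) ^ (Suc s - c))"
  proof -
    have "real (Suc s * ((Suc s - 1) choose (c - 1))) = real (Suc s) * b"
      by (simp add: b_def algebra_simps)
    moreover have "(1 - x) ^ (Suc s - c) = (1 - x) * (1 - x) ^ (s - c)"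
      using step.hyps by (simp add: Suc_diff_le)
    moreover have "real (Suc s - c) = real (Suc s) - real c"
      using step.hyps by (simp add: of_nat_diff)
    \<comment> \<open>With P = x^(c-1) and Q = (1-x)^(s-c) factored out, the telescoping is the
      identity (S-C) + C(1-x) - (S-C)x = S(1-x).\<close>
    moreover have "(S - C) * b * (P * Q) + b * (P * Q) * (C * (1 - x) - (S - C) * x) =
        S * b * (P * ((1 - x) * Q))" for S C P Q :: real
      by (simp add: algebra_simps)
    ultimately show ?thesis
      unfolding b by (simp only:)
  qed
  finally show ?case .
qed

text \<open>The derivative formula is integrated from 0, where the sum vanishes since c is positive.
  The exponents keep the shape produced by unfolding \<open>reg_inc_beta\<close>.\<close>

lemma integral_beta_integrand:
  fixes x :: real
  assumes "c \<ge> 1" "c \<le> s" "x \<in> {0..1}"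
  shows "real (s * ((s - 1) choose (c - 1))) *
      integral {0..x} (\<lambda>t. t powr (real c - 1) * (1 - t) powr (real s - real c + 1 - 1)) =
    (\<Sum>t=c..s. real ((t - 1) choose (c - 1)) * (1 - x) ^ (t - c) * x ^ c)"
proof -
  define K where "K = real (s * ((s - 1) choose (c - 1)))"
  define F where "F x = (\<Sum>t=c..s. real ((t - 1) choose (c - 1)) * (1 - x) ^ (t - c) * x ^ c)"
    for x :: real
  have "((\<lambda>t. K * (t ^ (c - 1) * (1 - t) ^ (s - c))) has_integral F x - F 0) {0..x}"
    using assms neg_binomial_cdf_deriv[OF assms(1,2)] unfolding F_def K_def
    by (intro fundamental_theorem_of_calculus)
      (auto simp flip: has_real_derivative_iff_has_vector_derivative)
  \<comment> \<open>At 0 and 1 the two integrands may differ, since \<open>0 powr 0\<close> is 0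
    while \<open>0 ^ 0\<close> is 1; finitely many points do not affect the integral.\<close>
  then have "((\<lambda>t. K * (t powr (real c - 1) * (1 - t) powr (real s - real c + 1 - 1)))
      has_integral F x - F 0) {0..x}"
  proof (rule has_integral_spike_finite[rotated 2])
    fix t assume "t \<in> {0..x} - {0, 1}"
    then have "t > 0" "1 - t > 0" using assms by auto
    then show "K * (t powr (real c - 1) * (1 - t) powr (real s - real c + 1 - 1)) =
        K * (t ^ (c - 1) * (1 - t) ^ (s - c))"
      using assms by (simp add: of_nat_diff flip: powr_realpow)
  qed auto
  then have "integral {0..x} (\<lambda>t. K * (t powr (real c - 1) * (1 - t) powr (real s - real c + 1 - 1))) =
      F x - F 0"
    by (rule integral_unique)
  moreover have "F 0 = 0"
    using assms by (simp add: F_def power_0_left)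
  ultimately show ?thesis
    unfolding K_def[symmetric] F_def[symmetric] by simp
qed

text \<open>The denominator is the same integral at x = 1, where only the summand t = c survives and
  equals 1. Hence \<open>K\<close> is the reciprocal of the complete beta integral and cancels in
  the quotient.\<close>

lemma reg_inc_beta_eq_neg_binomial_cdf:
  assumes "c \<ge> 1" "c \<le> s" "x \<in> {0..1}"
  shows "reg_inc_beta x (real c) (real s - real c + 1) =
    (\<Sum>t=c..s. real ((t - 1) choose (c - 1)) * (1 - x) ^ (t - c) * x ^ c)"
proof -
  define K where "K = real (s * ((s - 1) choose (c - 1)))"
  define J where "J x = integral {0..x} (\<lambda>t. t powr (real c - 1) * (1 - t) powr (real s - real c + 1 - 1))"
    for x :: real
  have "(\<Sum>t=c..s. real ((t - 1) choose (c - 1)) * (1 - 1) ^ (t - c) * 1 ^ c) =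
      (\<Sum>t=c..s. if t = c then 1 else (0::real))"
    by (intro sum.cong) auto
  also have "\<dots> = 1"
    using assms by simp
  finally have 1: "K * J 1 = 1"
    using integral_beta_integrand[OF assms(1,2), of 1] by (simp add: K_def J_def)
  then have "K \<noteq> 0" by auto
  have "reg_inc_beta x (real c) (real s - real c + 1) = J x / J 1"
    unfolding reg_inc_beta_def J_def ..
  also have "\<dots> = (K * J x) / (K * J 1)"
    using \<open>K \<noteq> 0\<close> by simp
  also have "\<dots> = K * J x"
    unfolding 1 by simp
  finally show ?thesis
    unfolding J_def K_def integral_beta_integrand[OF assms] .
qed

section \<open>The distribution and integrability of the maximum\<close>

lemma Ymax_le_iff:
  assumes "n \<ge> 1"
  shows "Ymax n c X \<omega> \<le> s \<longleftrightarrow> (\<forall>j\<in>{1..n}. Ysum c X j \<omega> \<le> s)"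
  unfolding Ymax_def using assms by (subst Max_le_iff) auto

context prob_space
begin

context
  fixes n c :: nat and p :: "nat \<Rightarrow> nat \<Rightarrow> real" and X :: "nat \<Rightarrow> nat \<Rightarrow> 'a \<Rightarrow> nat"
  assumes geo: "indep_geo M n c p X"
begin

lemma indep_geo_measurable:
  assumes "j \<in> {1..n}" "k \<in> {1..c}"
  shows "X j k \<in> M \<rightarrow>\<^sub>M count_space UNIV"
proof -
  have "random_variable (count_space UNIV) (case (j, k) of (j, k) \<Rightarrow> X j k)"
    using geo assms unfolding indep_geo_def indep_vars_def by blast
  then show ?thesis by simp
qed

lemma Ysum_measurable:
  assumes "j \<in> {1..n}"
  shows "Ysum c X j \<in> M \<rightarrow>\<^sub>M count_space UNIV"
  unfolding Ysum_def using assms by (intro measurable_sum_nat indep_geo_measurable)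

lemma Ymax_measurable:
  assumes "n \<ge> 1"
  shows "Ymax n c X \<in> M \<rightarrow>\<^sub>M count_space UNIV"
proof -
  note [measurable] = Ysum_measurable
  \<comment> \<open>The target is countable, so singletons suffice; finitely many comparisons of the
    row sums describe each level set.\<close>
  have "Ymax n c X -` {t} \<inter> space M =
      {\<omega>\<in>space M. (\<forall>j\<in>{1..n}. Ysum c X j \<omega> \<le> t) \<and> (\<exists>j\<in>{1..n}. t = Ysum c X j \<omega>)}" for t
  proof -
    have "Ymax n c X \<omega> = t \<longleftrightarrow>
        (\<forall>j\<in>{1..n}. Ysum c X j \<omega> \<le> t) \<and> (\<exists>j\<in>{1..n}. t = Ysum c X j \<omega>)" for \<omega>
      unfolding Ymax_def using assms by (subst Max_eq_iff) auto
    then show ?thesis by auto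
  qed
  also have "\<dots> t \<in> events" for t
    by measurable
  finally show ?thesis
    by (subst measurable_count_space_eq2_countable) auto
qed

text \<open>Only the law of \<open>X j k\<close> is prescribed, so the value 0 is excluded only up
  to a null set; later comparisons of events are therefore almost sure.\<close>

lemma AE_indep_geo_ge_1:
  assumes "j \<in> {1..n}" "k \<in> {1..c}"
  shows "AE \<omega> in M. X j k \<omega> \<ge> 1"
proof -
  have distr: "distr M (count_space UNIV) (X j k) = measure_pmf (Geo (p j k))"
    using geo assms unfolding indep_geo_def by blast
  have "AE x in distr M (count_space UNIV) (X j k). x \<ge> 1"
    unfolding distr by (auto simp: AE_measure_pmf_iff Geo_def)
  then show ?thesis
    using indep_geo_measurable[OF assms] by (rule AE_distrD[rotated])
qed

lemma AE_indep_geo_all_ge_1: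
  "AE \<omega> in M. \<forall>j\<in>{1..n}. \<forall>k\<in>{1..c}. X j k \<omega> \<ge> 1"
  using AE_indep_geo_ge_1 by (auto simp: AE_ball_countable)

lemma prob_indep_geo_eq:
  assumes "j \<in> {1..n}" "k \<in> {1..c}" "a \<ge> 1"
    and p: "\<And>j k. j \<in> {1..n} \<Longrightarrow> k \<in> {1..c} \<Longrightarrow> p j k \<in> {0<..1}"
  shows "prob (X j k -` {a} \<inter> space M) = (1 - p j k) ^ (a - 1) * p j k"
proof -
  have "prob (X j k -` {a} \<inter> space M) = measure (distr M (count_space UNIV) (X j k)) {a}"
    using indep_geo_measurable[OF assms(1,2)] by (simp add: measure_distr)
  also have "\<dots> = pmf (Geo (p j k)) a"
    using geo assms unfolding indep_geo_def by (simp add: pmf.rep_eq)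
  finally show ?thesis
    using p assms by (simp add: pmf_Geo)
qed

lemma prob_indep_geo_composition:
  assumes "j \<in> {1..n}" "c \<ge> 1" "\<alpha> \<in> compositions c t"
    and p: "\<And>j k. j \<in> {1..n} \<Longrightarrow> k \<in> {1..c} \<Longrightarrow> p j k \<in> {0<..1}"
  shows "prob {\<omega>\<in>space M. \<forall>k\<in>{1..c}. X j k \<omega> = \<alpha> k} =
    (\<Prod>k=1..c. (1 - p j k) ^ (\<alpha> k - 1) * p j k)"
proof -
  \<comment> \<open>Row j is the subfamily indexed by \<open>{j} \<times> {1..c}\<close>. It is
    nonempty because c is positive, so the intersection stays inside \<open>space M\<close>.\<close>
  have "{\<omega>\<in>space M. \<forall>k\<in>{1..c}. X j k \<omega> = \<alpha> k} =
      (\<Inter>i\<in>{j} \<times> {1..c}. (case i of (j, k) \<Rightarrow> X j k) -` {\<alpha> (snd i)} \<inter> space M)"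
    using assms(2) by fastforce
  also have "prob \<dots> =
      (\<Prod>i\<in>{j} \<times> {1..c}. prob ((case i of (j, k) \<Rightarrow> X j k) -` {\<alpha> (snd i)} \<inter> space M))"
  proof (rule indep_varsD)
    show "indep_vars (\<lambda>_. count_space UNIV) (\<lambda>(j, k). X j k) ({1..n} \<times> {1..c})"
      using geo by (simp add: indep_geo_def)
  qed (use assms(1,2) in auto)
  also have "\<dots> = (\<Prod>k=1..c. prob (X j k -` {\<alpha> k} \<inter> space M))"
    by (rule prod.reindex_bij_witness[of _ "\<lambda>k. (j, k)" snd]) auto
  also have "\<dots> = (\<Prod>k=1..c. (1 - p j k) ^ (\<alpha> k - 1) * p j k)"
    using assms(3) by (intro prod.cong refl prob_indep_geo_eq[OF assms(1) _ _ p]) (auto simp: compositions_def)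
  finally show ?thesis .
qed

text \<open>Up to a null set, the event is the finite disjoint union, over compositions of the
  totals t from c to s, of the events that row j equals the composition.\<close>

lemma prob_Ysum_le:
  assumes "j \<in> {1..n}" "c \<ge> 1"
    and p: "\<And>j k. j \<in> {1..n} \<Longrightarrow> k \<in> {1..c} \<Longrightarrow> p j k \<in> {0<..1}"
  shows "prob {\<omega>\<in>space M. Ysum c X j \<omega> \<le> s} =
    (\<Sum>t=c..s. \<Sum>\<alpha>\<in>compositions c t. \<Prod>k=1..c. (1 - p j k) ^ (\<alpha> k - 1) * p j k)"
proof -
  note [measurable] = indep_geo_measurable[OF assms(1)] Ysum_measurable[OF assms(1)]
  define I where "I = (SIGMA t:{c..s}. compositions c t)"
  define A where "A = (\<lambda>(t::nat, \<alpha>). {\<omega>\<in>space M. \<forall>k\<in>{1..c}. X j k \<omega> = \<alpha> k})"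
  have A: "A i \<in> events" for i
    unfolding A_def by (cases i) (simp only: prod.case, measurable)
  have fin: "finite I"
    unfolding I_def by (auto simp: finite_compositions)
  have eq: "Ysum c X j \<omega> \<le> s \<longleftrightarrow> \<omega> \<in> (\<Union>i\<in>I. A i)"
    if "\<omega> \<in> space M" and pos: "\<forall>k\<in>{1..c}. X j k \<omega> \<ge> 1" for \<omega>
  proof
    assume le: "Ysum c X j \<omega> \<le> s"
    \<comment> \<open>Restricting the row to \<open>{1..c}\<close> makes it extensional, as
      membership in \<open>compositions\<close> demands.\<close>
    define \<alpha> where "\<alpha> = (\<lambda>k\<in>{1..c}. X j k \<omega>)"
    have "(\<Sum>k=1..c. 1) \<le> Ysum c X j \<omega>"
      unfolding Ysum_def using pos by (intro sum_mono) auto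
    with le pos have "(Ysum c X j \<omega>, \<alpha>) \<in> I"
      by (auto simp: I_def compositions_def \<alpha>_def Ysum_def)
    moreover have "\<omega> \<in> A (Ysum c X j \<omega>, \<alpha>)"
      using that by (auto simp: A_def \<alpha>_def)
    ultimately show "\<omega> \<in> (\<Union>i\<in>I. A i)" by blast
  next
    assume "\<omega> \<in> (\<Union>i\<in>I. A i)"
    then obtain t \<alpha> where "t \<le> s" "\<alpha> \<in> compositions c t" "\<forall>k\<in>{1..c}. X j k \<omega> = \<alpha> k"
      by (auto simp: I_def A_def)
    then show "Ysum c X j \<omega> \<le> s"
      by (simp add: Ysum_def compositions_def)
  qed
  have disj: "disjoint_family_on A I"
  proof (unfold disjoint_family_on_def, intro ballI impI, rule ccontr)
    fix i i' assume i: "i \<in> I" "i' \<in> I" "i \<noteq> i'" and ne: "A i \<inter> A i' \<noteq> {}"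
    obtain t \<alpha> t' \<alpha>' where eqs: "i = (t, \<alpha>)" "i' = (t', \<alpha>')"
      by (cases i, cases i') auto
    from ne obtain \<omega> where *: "\<omega> \<in> A (t, \<alpha>)" "\<omega> \<in> A (t', \<alpha>')"
      by (auto simp: eqs)
    \<comment> \<open>A common outcome forces agreement on \<open>{1..c}\<close>, hence everywhere
      by extensionality; the totals, being the sums of the parts, then agree too.\<close>
    have "\<alpha> = \<alpha>'"
    proof (rule PiE_ext)
      show "\<alpha> \<in> {1..c} \<rightarrow>\<^sub>E {1..}" "\<alpha>' \<in> {1..c} \<rightarrow>\<^sub>E {1..}"
        using i by (simp_all add: I_def eqs compositions_def)
      show "\<alpha> k = \<alpha>' k" if "k \<in> {1..c}" for k
        using * that by (auto simp: A_def)
    qed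
    with i show False
      by (auto simp: I_def eqs compositions_def)
  qed
  have U: "{\<omega>\<in>space M. \<omega> \<in> (\<Union>i\<in>I. A i)} = (\<Union>i\<in>I. A i)"
    by (auto simp: A_def)
  have "prob {\<omega>\<in>space M. Ysum c X j \<omega> \<le> s} = prob {\<omega>\<in>space M. \<omega> \<in> (\<Union>i\<in>I. A i)}"
  proof (rule prob_eq_AE)
    show "AE \<omega> in M. (Ysum c X j \<omega> \<le> s) = (\<omega> \<in> (\<Union>i\<in>I. A i))"
      using AE_indep_geo_all_ge_1 AE_space by eventually_elim (use eq assms(1) in blast)
    show "{\<omega>\<in>space M. \<omega> \<in> (\<Union>i\<in>I. A i)} \<in> events"
      unfolding U using A fin by auto
  qed measurable
  also have "{\<omega>\<in>space M. \<omega> \<in> (\<Union>i\<in>I. A i)} = (\<Union>i\<in>I. A i)"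
    by (rule U)
  also have "prob \<dots> = (\<Sum>i\<in>I. prob (A i))"
    using A fin disj by (intro finite_measure_finite_Union) auto
  also have "\<dots> = (\<Sum>t=c..s. \<Sum>\<alpha>\<in>compositions c t. prob (A (t, \<alpha>)))"
    unfolding I_def by (subst sum.Sigma) (auto simp: finite_compositions)
  also have "\<dots> = (\<Sum>t=c..s. \<Sum>\<alpha>\<in>compositions c t. \<Prod>k=1..c. (1 - p j k) ^ (\<alpha> k - 1) * p j k)"
    unfolding A_def prod.case
    by (intro sum.cong refl prob_indep_geo_composition[OF assms(1,2) _ p])
  finally show ?thesis .
qed

text \<open>The rows are disjoint blocks of an independent family, and each sum is a measurable
  function of its own block.\<close>

lemma indep_vars_Ysum:
  "indep_vars (\<lambda>_. count_space UNIV) (Ysum c X) {1..n}"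
proof -
  have "indep_vars (\<lambda>j. PiM ({j} \<times> {1..c}) (\<lambda>_. count_space UNIV))
      (\<lambda>j \<omega>. restrict (\<lambda>i. (case i of (j, k) \<Rightarrow> X j k) \<omega>) ({j} \<times> {1..c})) {1..n}"
    using geo unfolding indep_geo_def
    by (intro indep_vars_restrict) (auto simp: disjoint_family_on_def)
  then have "indep_vars (\<lambda>_. count_space UNIV)
      (\<lambda>j \<omega>. \<Sum>k=1..c. restrict (\<lambda>i. (case i of (j, k) \<Rightarrow> X j k) \<omega>) ({j} \<times> {1..c}) (j, k)) {1..n}"
    by (rule indep_vars_compose2) (auto intro!: measurable_sum_nat measurable_component_singleton)
  also have "?this \<longleftrightarrow> ?thesis"
    by (rule indep_vars_cong) (auto simp: Ysum_def fun_eq_iff)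
  finally show ?thesis .
qed

lemma prob_Ymax_le:
  assumes "n \<ge> 1" "c \<ge> 1"
    and p: "\<And>j k. j \<in> {1..n} \<Longrightarrow> k \<in> {1..c} \<Longrightarrow> p j k \<in> {0<..1}"
  shows "prob {\<omega>\<in>space M. Ymax n c X \<omega> \<le> s} = (\<Prod>j=1..n. \<Sum>t=c..s. \<Sum>\<alpha>\<in>compositions c t.
    \<Prod>k=1..c. (1 - p j k) ^ (\<alpha> k - 1) * p j k)"
proof -
  have "{\<omega>\<in>space M. Ymax n c X \<omega> \<le> s} = (\<Inter>j\<in>{1..n}. Ysum c X j -` {..s} \<inter> space M)"
    using assms by (auto simp: Ymax_le_iff)
  also have "prob \<dots> = (\<Prod>j=1..n. prob (Ysum c X j -` {..s} \<inter> space M))"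
    using assms by (intro indep_varsD_finite[OF indep_vars_Ysum]) auto
  also have "\<dots> = (\<Prod>j=1..n. prob {\<omega>\<in>space M. Ysum c X j \<omega> \<le> s})"
    by (intro prod.cong arg_cong[of _ _ prob]) auto
  also have "\<dots> = (\<Prod>j=1..n. \<Sum>t=c..s. \<Sum>\<alpha>\<in>compositions c t.
      \<Prod>k=1..c. (1 - p j k) ^ (\<alpha> k - 1) * p j k)"
    by (intro prod.cong refl prob_Ysum_le[OF _ assms(2) p])
  finally show ?thesis .
qed

text \<open>The maximum is one of the row sums, and a row sum is at most c times its largest entry.
  So the r-th power is dominated by c^r times the sum of the r-th powers of all entries.\<close>

lemma integrable_Ymax_power:
  assumes "n \<ge> 1" "c \<ge> 1"
    and p: "\<And>j k. j \<in> {1..n} \<Longrightarrow> k \<in> {1..c} \<Longrightarrow> p j k \<in> {0<..1}"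
  shows "integrable M (\<lambda>\<omega>. real (Ymax n c X \<omega>) ^ r)"
proof (rule Bochner_Integration.integrable_bound)
  have "integrable M (\<lambda>\<omega>. real (X j k \<omega>) ^ r)" if "j \<in> {1..n}" "k \<in> {1..c}" for j k
  proof -
    have "integrable (distr M (count_space UNIV) (X j k)) (\<lambda>x. real x ^ r)"
      using geo p that unfolding indep_geo_def by (simp add: integrable_power_Geo)
    then show ?thesis
      using indep_geo_measurable[OF that] by (subst (asm) integrable_distr_eq) auto
  qed
  then show "integrable M (\<lambda>\<omega>. real c ^ r * (\<Sum>j=1..n. \<Sum>k=1..c. real (X j k \<omega>) ^ r))"
    by (intro integrable_mult_right Bochner_Integration.integrable_sum)
  show "(\<lambda>\<omega>. real (Ymax n c X \<omega>) ^ r) \<in> borel_measurable M"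
    using Ymax_measurable[OF assms(1)] by measurable
  show "AE \<omega> in M. norm (real (Ymax n c X \<omega>) ^ r) \<le>
      norm (real c ^ r * (\<Sum>j=1..n. \<Sum>k=1..c. real (X j k \<omega>) ^ r))"
  proof (rule AE_I2)
    fix \<omega>
    have "Ymax n c X \<omega> \<in> (\<lambda>j. Ysum c X j \<omega>) ` {1..n}"
      unfolding Ymax_def using assms by (intro Max_in) auto
    then obtain j where j: "j \<in> {1..n}" "Ymax n c X \<omega> = Ysum c X j \<omega>" by blast
    have "Max ((\<lambda>k. X j k \<omega>) ` {1..c}) \<in> (\<lambda>k. X j k \<omega>) ` {1..c}"
      using assms by (intro Max_in) auto
    then obtain k where k: "k \<in> {1..c}" "Max ((\<lambda>k. X j k \<omega>) ` {1..c}) = X j k \<omega>" by force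
    have "Ysum c X j \<omega> \<le> (\<Sum>i=1..c. X j k \<omega>)"
      unfolding Ysum_def k(2)[symmetric] by (intro sum_mono Max_ge) auto
    then have "real (Ymax n c X \<omega>) \<le> real c * real (X j k \<omega>)"
      unfolding j(2) by (simp flip: of_nat_mult)
    then have "real (Ymax n c X \<omega>) ^ r \<le> real c ^ r * real (X j k \<omega>) ^ r"
      by (subst power_mult_distrib[symmetric], intro power_mono) auto
    also have "real (X j k \<omega>) ^ r \<le> (\<Sum>k=1..c. real (X j k \<omega>) ^ r)"
      using k by (intro member_le_sum) auto
    also have "\<dots> \<le> (\<Sum>j=1..n. \<Sum>k=1..c. real (X j k \<omega>) ^ r)"
      using j by (intro member_le_sum[of j "{1..n}" "\<lambda>j. \<Sum>k=1..c. real (X j k \<omega>) ^ r"])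
        (auto intro: sum_nonneg)
    finally show "norm (real (Ymax n c X \<omega>) ^ r) \<le>
        norm (real c ^ r * (\<Sum>j=1..n. \<Sum>k=1..c. real (X j k \<omega>) ^ r))"
      by (simp add: mult_left_mono sum_nonneg)
  qed
qed

end

section \<open>Tail sums and the moment formula\<close>

text \<open>The tail formula holds in \<open>ennreal\<close> without convergence questions;
  integrability makes the total finite, so it descends to the reals, and nonnegativity gives
  unconditional summation.\<close>

lemma has_sum_prob_gt_nat:
  fixes N :: "'a \<Rightarrow> nat"
  assumes [measurable]: "N \<in> M \<rightarrow>\<^sub>M count_space UNIV"
    and int: "integrable M (\<lambda>\<omega>. real (N \<omega>))"
  shows "((\<lambda>m. prob {\<omega>\<in>space M. m < N \<omega>}) has_sum expectation (\<lambda>\<omega>. real (N \<omega>))) UNIV"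
proof -
  have "(\<Sum>m. ennreal (prob {\<omega>\<in>space M. m < N \<omega>})) = (\<integral>\<^sup>+\<omega>. ennreal (real (N \<omega>)) \<partial>M)"
    by (subst ennreal_of_nat_eq_real_of_nat[symmetric], subst nn_integral_nat_function)
      (auto simp: emeasure_eq_measure)
  also have "\<dots> = ennreal (expectation (\<lambda>\<omega>. real (N \<omega>)))"
    using int by (intro nn_integral_eq_integral) auto
  finally have sum_eq: "(\<Sum>m. ennreal (prob {\<omega>\<in>space M. m < N \<omega>})) =
      ennreal (expectation (\<lambda>\<omega>. real (N \<omega>)))" .
  have "(\<lambda>m. ennreal (prob {\<omega>\<in>space M. m < N \<omega>})) sums
      ennreal (expectation (\<lambda>\<omega>. real (N \<omega>)))"
    unfolding sum_eq[symmetric] by (intro summable_sums summableI)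
  then have "(\<lambda>m. prob {\<omega>\<in>space M. m < N \<omega>}) sums expectation (\<lambda>\<omega>. real (N \<omega>))"
    by (subst (asm) sums_ennreal) auto
  then show ?thesis
    by (rule sums_nonneg_imp_has_sum) auto
qed

text \<open>The parameter array is arbitrary in (0,1], so that both parts of the theorem are
  instances.\<close>

lemma expectation_Ymax_power:
  assumes geo: "indep_geo M n c p X"
    and p: "\<And>j k. j \<in> {1..n} \<Longrightarrow> k \<in> {1..c} \<Longrightarrow> p j k \<in> {0<..1}"
    and pos: "n \<ge> 1" "c \<ge> 1" "r \<ge> 1"
  shows "((\<lambda>m. 1 - (\<Prod>j=1..n. \<Sum>t=c..floor_root r m. \<Sum>\<alpha>\<in>compositions c t.
      \<Prod>k=1..c. (1 - p j k) ^ (\<alpha> k - 1) * p j k))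
    has_sum (expectation (\<lambda>\<omega>. real (Ymax n c X \<omega>) ^ r) - real (c ^ r))) {c ^ r..}"
proof -
  note [measurable] = Ymax_measurable[OF geo pos(1)]
  define T where "T m = prob {\<omega>\<in>space M. m < Ymax n c X \<omega> ^ r}" for m
  have T: "(T has_sum expectation (\<lambda>\<omega>. real (Ymax n c X \<omega>) ^ r)) UNIV"
    using has_sum_prob_gt_nat[of "\<lambda>\<omega>. Ymax n c X \<omega> ^ r"] integrable_Ymax_power[OF geo pos(1,2) p]
    by (simp add: T_def[abs_def])
  have T1: "T m = 1" if "m < c ^ r" for m
  proof -
    have "AE \<omega> in M. m < Ymax n c X \<omega> ^ r"
      using AE_indep_geo_all_ge_1[OF geo]
    proof eventually_elim
      fix \<omega> assume *: "\<forall>j\<in>{1..n}. \<forall>k\<in>{1..c}. X j k \<omega> \<ge> 1"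
      have "(\<Sum>k=1..c. 1) \<le> Ysum c X 1 \<omega>"
        unfolding Ysum_def using * pos by (intro sum_mono) auto
      also have "\<dots> \<le> Ymax n c X \<omega>"
        using Ymax_le_iff[OF pos(1), of c X \<omega> "Ymax n c X \<omega>"] pos by simp
      finally have "c ^ r \<le> Ymax n c X \<omega> ^ r"
        by (simp add: power_mono)
      with that show "m < Ymax n c X \<omega> ^ r" by simp
    qed
    then show ?thesis
      unfolding T_def by (subst prob_Collect_eq_1) auto
  qed
  have T_eq: "T m = 1 - (\<Prod>j=1..n. \<Sum>t=c..floor_root r m. \<Sum>\<alpha>\<in>compositions c t.
      \<Prod>k=1..c. (1 - p j k) ^ (\<alpha> k - 1) * p j k)" if "m \<in> {c ^ r..}" for m
  proof -
    \<comment> \<open>Since c^r is at least 1, the floor-root equivalence is available on the whole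
      index set.\<close>
    have "m \<ge> 1"
      using that pos by (metis atLeast_iff one_le_power order_trans)
    then have "{\<omega>\<in>space M. m < Ymax n c X \<omega> ^ r} =
        {\<omega>\<in>space M. \<not> Ymax n c X \<omega> \<le> floor_root r m}"
      using le_floor_root_iff[OF pos(3)] by auto
    then show ?thesis
      unfolding T_def by (subst prob_Ymax_le[OF geo pos(1,2) p, symmetric])
        (auto simp: prob_neg)
  qed
  \<comment> \<open>The c^r removed terms all equal 1, which accounts for the subtracted
    constant.\<close>
  have "(T has_sum (expectation (\<lambda>\<omega>. real (Ymax n c X \<omega>) ^ r) - real (c ^ r)))
      (UNIV - {..<c ^ r})"
    using T1 by (intro has_sum_Diff T has_sum_finiteI) auto
  moreover have "UNIV - {..<c ^ r} = {c ^ r..}" by auto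
  ultimately have "(T has_sum (expectation (\<lambda>\<omega>. real (Ymax n c X \<omega>) ^ r) - real (c ^ r))) {c ^ r..}"
    by simp
  then show ?thesis
    by (rule has_sum_cong[THEN iffD1, rotated]) (rule T_eq)
qed

end

section \<open>The two choices of parameters\<close>

theorem proposition9:
  fixes M :: "'a measure" and X :: "nat \<Rightarrow> nat \<Rightarrow> 'a \<Rightarrow> nat"
    and n c r :: nat and q :: "nat \<Rightarrow> real"
  assumes "prob_space M"
    and "n \<ge> 1" and "c \<ge> 1" and "r \<ge> 1"
    and "\<And>j. j \<in> {1..n} \<Longrightarrow> q j \<in> {0<..<1}"
  shows
    "(\<forall>d::nat. \<forall>p. d \<ge> 2 \<longrightarrow>
        p = (\<lambda>j k. (1 - real d powi (int k - 1 - int c)) * q j) \<longrightarrow>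
        indep_geo M n c p X \<longrightarrow>
          (let F = (\<lambda>m. 1 - (\<Prod>j=1..n. \<Sum>t=c..floor_root r m. \<Sum>\<alpha>\<in>compositions c t.
                      \<Prod>k=1..c. (1 - p j k) ^ (\<alpha> k - 1) * p j k))
           in integrable M (\<lambda>\<omega>. real (Ymax n c X \<omega>) ^ r) \<and>
              F summable_on {c ^ r..} \<and>
              prob_space.expectation M (\<lambda>\<omega>. real (Ymax n c X \<omega>) ^ r)
                = real (c ^ r) + (\<Sum>\<^sub>\<infinity>m\<in>{c ^ r..}. F m))) \<and>
     (indep_geo M n c (\<lambda>j k. q j) X \<longrightarrow>
          (let G = (\<lambda>m. 1 - (\<Prod>j=1..n. \<Sum>t=c..floor_root r m.
                      real ((t - 1) choose (c - 1)) * (1 - q j) ^ (t - c) * q j ^ c));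
               H = (\<lambda>m. 1 - (\<Prod>j=1..n.
                      reg_inc_beta (q j) (real c) (real (floor_root r m) - real c + 1)))
           in integrable M (\<lambda>\<omega>. real (Ymax n c X \<omega>) ^ r) \<and>
              G summable_on {c ^ r..} \<and> H summable_on {c ^ r..} \<and>
              prob_space.expectation M (\<lambda>\<omega>. real (Ymax n c X \<omega>) ^ r)
                = real (c ^ r) + (\<Sum>\<^sub>\<infinity>m\<in>{c ^ r..}. G m) \<and>
              real (c ^ r) + (\<Sum>\<^sub>\<infinity>m\<in>{c ^ r..}. G m)
                = real (c ^ r) + (\<Sum>\<^sub>\<infinity>m\<in>{c ^ r..}. H m)))"
proof -
  interpret prob_space M by fact
  note pos = \<open>n \<ge> 1\<close> \<open>c \<ge> 1\<close> \<open>r \<ge> 1\<close>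
  define S where "S p m = 1 - (\<Prod>j=1..n. \<Sum>t=c..floor_root r m. \<Sum>\<alpha>\<in>compositions c t.
    \<Prod>k=1..c. (1 - p j k) ^ (\<alpha> k - 1) * p j k)" for p :: "nat \<Rightarrow> nat \<Rightarrow> real" and m
  have main: "integrable M (\<lambda>\<omega>. real (Ymax n c X \<omega>) ^ r) \<and>
      (S p has_sum (expectation (\<lambda>\<omega>. real (Ymax n c X \<omega>) ^ r) - real (c ^ r))) {c ^ r..}"
    if "indep_geo M n c p X" "\<And>j k. j \<in> {1..n} \<Longrightarrow> k \<in> {1..c} \<Longrightarrow> p j k \<in> {0<..1}" for p
    unfolding S_def using that pos
    by (intro conjI integrable_Ymax_power expectation_Ymax_power)
  show ?thesis
  proof (intro conjI allI impI)
    fix d :: nat and p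
    assume d: "d \<ge> 2" and p: "p = (\<lambda>j k. (1 - real d powi (int k - 1 - int c)) * q j)"
      and geo: "indep_geo M n c p X"
    have "p j k \<in> {0<..1}" if "j \<in> {1..n}" "k \<in> {1..c}" for j k
    proof -
      \<comment> \<open>Since k is at most c, the exponent is the negative of c + 1 - k, which is at
        least 1. Thus the power of d is below 1 and the factor in front of \<open>q j\<close> lies
        strictly between 0 and 1.\<close>
      have "int k - 1 - int c = - int (Suc c - k)"
        using that by auto
      then have "real d powi (int k - 1 - int c) = inverse (real d ^ (Suc c - k))"
        by (simp only: power_int_minus power_int_of_nat)
      moreover have "real d ^ (Suc c - k) > 1"
        using d that by (intro one_less_power) auto
      ultimately have "1 - real d powi (int k - 1 - int c) \<in> {0<..<1}"
        using d by (auto simp: inverse_less_1_iff)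
      moreover have "q j \<in> {0<..<1}"
        using assms(5) that by blast
      ultimately show ?thesis
        unfolding p by (auto intro: mult_le_one)
    qed
    with geo have *: "integrable M (\<lambda>\<omega>. real (Ymax n c X \<omega>) ^ r) \<and>
        (S p has_sum (expectation (\<lambda>\<omega>. real (Ymax n c X \<omega>) ^ r) - real (c ^ r))) {c ^ r..}"
      by (rule main)
    then have "S p summable_on {c ^ r..}"
      "infsum (S p) {c ^ r..} = expectation (\<lambda>\<omega>. real (Ymax n c X \<omega>) ^ r) - real (c ^ r)"
      by (auto simp: has_sum_iff)
    with * show "let F = (\<lambda>m. 1 - (\<Prod>j=1..n. \<Sum>t=c..floor_root r m. \<Sum>\<alpha>\<in>compositions c t.
            \<Prod>k=1..c. (1 - p j k) ^ (\<alpha> k - 1) * p j k))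
        in integrable M (\<lambda>\<omega>. real (Ymax n c X \<omega>) ^ r) \<and>
           F summable_on {c ^ r..} \<and>
           expectation (\<lambda>\<omega>. real (Ymax n c X \<omega>) ^ r)
             = real (c ^ r) + (\<Sum>\<^sub>\<infinity>m\<in>{c ^ r..}. F m)"
      unfolding Let_def S_def[symmetric] by simp
  next
    assume geo: "indep_geo M n c (\<lambda>j k. q j) X"
    define G where "G m = 1 - (\<Prod>j=1..n. \<Sum>t=c..floor_root r m.
      real ((t - 1) choose (c - 1)) * (1 - q j) ^ (t - c) * q j ^ c)" for m
    define H where "H m = 1 - (\<Prod>j=1..n.
      reg_inc_beta (q j) (real c) (real (floor_root r m) - real c + 1))" for m
    have q: "q j \<in> {0<..1}" if "j \<in> {1..n}" for j
      using assms(5)[OF that] by auto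
    have SG: "S (\<lambda>j k. q j) m = G m" for m
      unfolding S_def G_def using pos
      by (intro arg_cong[of _ _ "\<lambda>x. 1 - x"] prod.cong sum.cong refl sum_compositions_geometric) auto
    \<comment> \<open>From c^r onward the floor root is at least c, so the second beta parameter is
      at least 1 and the incomplete beta identity applies.\<close>
    have GH: "G m = H m" if "m \<in> {c ^ r..}" for m
    proof -
      have "m \<ge> 1"
        using that pos by (metis atLeast_iff one_le_power order_trans)
      then have "c \<le> floor_root r m"
        using that pos by (simp add: le_floor_root_iff)
      then show ?thesis
        unfolding G_def H_def using pos q
        by (intro arg_cong[of _ _ "\<lambda>x. 1 - x"] prod.cong refl
            reg_inc_beta_eq_neg_binomial_cdf[symmetric]) force+
    qed
    have "integrable M (\<lambda>\<omega>. real (Ymax n c X \<omega>) ^ r) \<and>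
        (S (\<lambda>j k. q j) has_sum (expectation (\<lambda>\<omega>. real (Ymax n c X \<omega>) ^ r) - real (c ^ r))) {c ^ r..}"
      using geo q by (rule main)
    then have *: "integrable M (\<lambda>\<omega>. real (Ymax n c X \<omega>) ^ r)"
      and G: "(G has_sum (expectation (\<lambda>\<omega>. real (Ymax n c X \<omega>) ^ r) - real (c ^ r))) {c ^ r..}"
      by (simp_all add: SG[abs_def])
    have H: "(H has_sum (expectation (\<lambda>\<omega>. real (Ymax n c X \<omega>) ^ r) - real (c ^ r))) {c ^ r..}"
      using G by (rule has_sum_cong[THEN iffD1, rotated]) (rule GH)
    show "let G = (\<lambda>m. 1 - (\<Prod>j=1..n. \<Sum>t=c..floor_root r m.
            real ((t - 1) choose (c - 1)) * (1 - q j) ^ (t - c) * q j ^ c));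
          H = (\<lambda>m. 1 - (\<Prod>j=1..n.
            reg_inc_beta (q j) (real c) (real (floor_root r m) - real c + 1)))
        in integrable M (\<lambda>\<omega>. real (Ymax n c X \<omega>) ^ r) \<and>
           G summable_on {c ^ r..} \<and> H summable_on {c ^ r..} \<and>
           expectation (\<lambda>\<omega>. real (Ymax n c X \<omega>) ^ r)
             = real (c ^ r) + (\<Sum>\<^sub>\<infinity>m\<in>{c ^ r..}. G m) \<and>
           real (c ^ r) + (\<Sum>\<^sub>\<infinity>m\<in>{c ^ r..}. G m)
             = real (c ^ r) + (\<Sum>\<^sub>\<infinity>m\<in>{c ^ r..}. H m)"
      unfolding Let_def G_def[symmetric] H_def[symmetric]
      using * G H by (simp add: has_sum_iff)
  qed
qed

end
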